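(* Consider the autonomous ($\epsilon=0$) mechanical system $\mathbf M\ddot y+\mathbf C\dot y+\mathbf K y+f(y,\dot y)=0$, its first-order form $\mathbf B\dot z=\mathbf A z+F(z)$, and the autonomous invariance equation $$\mathbf B\,(DW(p))\,R(p)=\mathbf A\,W(p)+F(W(p)),\qquad W=\begin{bmatrix} w\\ \dot w\end{bmatrix},$$ for the power series $w(p)=\sum_{m}w_m p^m$, $\dot w(p)=\sum_m \dot w_m p^m$, $R(p)=\sum_m R_m p^m$ ($m\in\mathbb N^M$), with the leading-order terms fixed as described in the context. Let $m\in\mathbb N^M$ be a multi-index with $|m|\ge 2$, and let all coefficients of order less than $|m|$ be given. Then the coefficient of $p^m$ in the invariance equation can be written, after elimination of the velocity coefficient $\dot w_m$, as the $n$-dimensional linear system $$\big(\mathbf K+\Lambda_m\mathbf C+\Lambda_m^2\mathbf M\big)\,w_m=\mathbf D_m R_m+\mathbf C_m .$$ That is, for given $w_m\in\mathbb C^n$ and $R_m\in\mathbb C^M$, there is $\dot w_m\in\mathbb C^n$ such that the $p^m$-coefficient of the invariance equation holds if and only if this linear system holds. Here $\Lambda_m=\sum_{j=1}^M\lambda_j m_j$, $\mathbf D_m\in\mathbb C^{n\times M}$ is the matrix whose $j$-th column is $-\big((\Lambda_m+\lambda_j)\mathbf M+\mathbf C\big)\phi_j$, and $\mathbf C_m:=-\Lambda_m\mathbf M V_m-Y_m\in\mathbb C^n$ with $$V_m:=\sum_{j=1}^M\ \sum_{\substack{u,k\in\mathbb N^M\\ 1<|u|<|m|\\ u+k-e_j=m}}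 w_u\,u_j\,R^j_k,$$ $$Y_m:=\sum_{j=1}^M\ \sum_{\substack{u,k\in\mathbb N^M\\ 1<|u|<|m|\\ u+k-e_j=m}} \mathbf M\,\dot w_u\,u_j\,R^j_k+\mathbf C V_m-\sum_{\nu\in\mathbb N^{2n}} f_\nu H_{\nu,m}.$$
   Context: $\mathbf M,\mathbf C,\mathbf K\in\mathbb R^{n\times n}$ are the mass, damping and stiffness matrices, $N=2n$, and $$z=\begin{bmatrix}y\\ \dot y\end{bmatrix},\quad \mathbf A=\begin{bmatrix}-\mathbf K&0\\0&\mathbf M\end{bmatrix},\quad \mathbf B=\begin{bmatrix}\mathbf C&\mathbf M\\ \mathbf M&0\end{bmatrix},\quad F(z)=\begin{bmatrix}-f(y,\dot y)\\0\end{bmatrix}.$$ The nonlinearity $f$ has no constant or linear terms and is expanded in a (formal) power series; write $F(z)=\sum_{\nu\in\mathbb N^{2n}}F_\nu z^\nu$, $F_\nu=\begin{bmatrix}f_\nu\\0\end{bmatrix}$ with $f_\nu\in\mathbb C^n$ (so $f_\nu$ are the Taylor coefficients of the upper block of $F$). $M$ is the (even) dimension of the chosen master spectral subspace. Its eigenvalues, closed under complex conjugation, are listed as $\lambda_1,\dots,\lambda_M$, with corresponding $\phi_j\in\mathbb C^n$ satisfying $(\lambda_j^2\mathbf M+\lambda_j\mathbf C+\mathbf K)\phi_j=0$. $w_m,\dot w_m\in\mathbb C^n$; the symbol $\dot w$ just denotes the second (velocity) block of $W$. $R_m=(R^1_m,\dots,R^M_m)^T\in\mathbb C^M$. Zeroth-order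 coefficients vanish: $w_0=\dot w_0=0$, $R_0=0$. The leading-order terms are chosen as $w_{e_j}=\phi_j$, $\dot w_{e_j}=\lambda_j\phi_j$, $R^i_{e_j}=\delta_{ij}\lambda_j$, where $e_j$ is the $j$-th unit multi-index. Multi-indices: for $m\in\mathbb N^M$ ($\mathbb N$ including $0$), $|m|=\sum_j m_j$ and $p^m=p_1^{m_1}\cdots p_M^{m_M}$; $u_j$ denotes the $j$-th entry of $u$. All equations are understood as identities of (formal) power series in $p$. Composition coefficients: for $\nu\in\mathbb N^{2n}$ and $h\in\mathbb N^M$, $H_{\nu,h}$ is the coefficient of $p^h$ in $W(p)^\nu=\prod_{i=1}^{2n}W^i(p)^{\nu_i}$, where $W^i$ is the $i$-th component of $W$. *)

theory Defs
  imports "HOL-Analysis.Analysis" "HOL-Library.Groups_Big_Fun"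
begin

text \<open>Multi-indices are vectors of type \<^typ>\<open>nat ^ 'm\<close>, with componentwise addition; the unit
  multi-index \<open>e\<^sub>j\<close> is \<^term>\<open>axis j 1 :: nat ^ 'm\<close>.\<close>

definition mdeg :: "nat ^ 'm \<Rightarrow> nat" where
  "mdeg m = (\<Sum>j\<in>UNIV. m $ j)"

typedef ('a, 'm) mfps = "UNIV :: (nat ^ 'm \<Rightarrow> 'a) set"
  morphisms mfps_nth Abs_mfps ..

lemma mfps_nth_Abs [simp]: "mfps_nth (Abs_mfps f) m = f m"
  by (simp add: Abs_mfps_inverse)

lemma mfps_eqI: "(\<And>m. mfps_nth a m = mfps_nth b m) \<Longrightarrow> a = b"
  by (metis ext mfps_nth_inject)

lemma finite_multiindex_splits: "finite {(u, k). u + k = (h :: nat ^ 'm)}"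
proof -
  have fin: "finite {u :: nat ^ 'm. \<forall>i. u $ i \<le> h $ i}"
  proof -
    have "{u :: nat ^ 'm. \<forall>i. u $ i \<le> h $ i} \<subseteq> vec_lambda ` (PiE UNIV (\<lambda>i. {..h $ i}))"
    proof
      fix u :: "nat ^ 'm" assume "u \<in> {u. \<forall>i. u $ i \<le> h $ i}"
      then have "u = vec_lambda (vec_nth u)" "vec_nth u \<in> PiE UNIV (\<lambda>i. {..h $ i})"
        by (auto simp: PiE_def)
      then show "u \<in> vec_lambda ` (PiE UNIV (\<lambda>i. {..h $ i}))"
        by blast
    qed
    then show ?thesis
      by (rule finite_subset) (intro finite_imageI finite_PiE, auto)
  qed
  have "{(u, k). u + k = h} \<subseteq> {u. \<forall>i. u $ i \<le> h $ i} \<times> {u. \<forall>i. u $ i \<le> h $ i}"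
    by auto
  then show ?thesis
    by (rule finite_subset) (intro finite_cartesian_product fin)
qed

instantiation mfps :: (comm_ring_1, finite) comm_ring_1
begin

definition "0 = Abs_mfps (\<lambda>_. 0)"
definition "1 = Abs_mfps (\<lambda>h. if h = 0 then 1 else 0)"
definition "a + b = Abs_mfps (\<lambda>h. mfps_nth a h + mfps_nth b h)"
definition "a - b = Abs_mfps (\<lambda>h. mfps_nth a h - mfps_nth b h)"
definition "- a = Abs_mfps (\<lambda>h. - mfps_nth a h)"
definition "a * b = Abs_mfps (\<lambda>h. \<Sum>(u, k)\<in>{(u, k). u + k = h}. mfps_nth a u * mfps_nth b k)"

instance
proof
  fix a b c :: "('a, 'b) mfps"
  note defs = zero_mfps_def one_mfps_def plus_mfps_def minus_mfps_def uminus_mfps_def times_mfps_def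
  have fin: "finite {(u, k). u + k = (h :: nat ^ 'b)}" for h
    by (rule finite_multiindex_splits)
  show "a + b + c = a + (b + c)" "a + b = b + a" "0 + a = a" "- a + a = 0" "a - b = a + - b"
    by (auto intro!: mfps_eqI simp: defs)
  show "(0 :: ('a, 'b) mfps) \<noteq> 1"
  proof
    assume "(0 :: ('a, 'b) mfps) = 1"
    then have "mfps_nth (0 :: ('a, 'b) mfps) 0 = mfps_nth 1 0" by simp
    then show False by (simp add: defs)
  qed
  show "(a + b) * c = a * c + b * c"
    by (rule mfps_eqI) (simp add: defs case_prod_unfold distrib_right sum.distrib)
  show "a * b = b * a"
  proof (rule mfps_eqI)
    fix h
    show "mfps_nth (a * b) h = mfps_nth (b * a) h"
      unfolding times_mfps_def mfps_nth_Abs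
      by (rule sum.reindex_bij_witness[of _ prod.swap prod.swap])
        (auto simp: add.commute mult.commute)
  qed
  show "1 * a = a"
  proof (rule mfps_eqI)
    fix h
    have "mfps_nth (1 * a) h =
        (\<Sum>p\<in>{(u, k). u + k = h}. if p = (0, h) then mfps_nth a h else 0)"
      unfolding defs mfps_nth_Abs by (rule sum.cong) (auto split: if_splits)
    also have "\<dots> = mfps_nth a h"
      using fin by (subst sum.delta) auto
    finally show "mfps_nth (1 * a) h = mfps_nth a h" .
  qed
  show "a * b * c = a * (b * c)"
  proof (rule mfps_eqI)
    fix h
    have "mfps_nth (a * b * c) h =
        (\<Sum>p\<in>{(u, k). u + k = h}. \<Sum>q\<in>{(u, k). u + k = fst p}.
           mfps_nth a (fst q) * mfps_nth b (snd q) * mfps_nth c (snd p))"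
      by (simp add: times_mfps_def case_prod_unfold sum_distrib_right)
    also have "\<dots> = (\<Sum>(p, q)\<in>(SIGMA p:{(u, k). u + k = h}. {(u, k). u + k = fst p}).
           mfps_nth a (fst q) * mfps_nth b (snd q) * mfps_nth c (snd p))"
      by (rule sum.Sigma) (auto intro: fin)
    also have "\<dots> = (\<Sum>(p, q)\<in>(SIGMA p:{(u, k). u + k = h}. {(u, k). u + k = snd p}).
           mfps_nth a (fst p) * (mfps_nth b (fst q) * mfps_nth c (snd q)))"
      by (rule sum.reindex_bij_witness
          [of _ "\<lambda>(p, q). ((fst p + fst q, snd q), (fst p, fst q))"
                "\<lambda>(p, q). ((fst q, snd q + snd p), (snd q, snd p))"])
        (auto simp: algebra_simps)
    also have "\<dots> = (\<Sum>p\<in>{(u, k). u + k = h}. \<Sum>q\<in>{(u, k). u + k = snd p}.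
           mfps_nth a (fst p) * (mfps_nth b (fst q) * mfps_nth c (snd q)))"
      by (rule sum.Sigma[symmetric]) (auto intro: fin)
    also have "\<dots> = mfps_nth (a * (b * c)) h"
      by (simp add: times_mfps_def case_prod_unfold sum_distrib_left)
    finally show "mfps_nth (a * b * c) h = mfps_nth (a * (b * c)) h" .
  qed
qed

end

definition mfps_const :: "'a :: zero \<Rightarrow> ('a, 'm :: finite) mfps" where
  "mfps_const c = Abs_mfps (\<lambda>h. if h = 0 then c else 0)"

definition mfps_deriv :: "'m \<Rightarrow> ('a :: comm_ring_1, 'm :: finite) mfps \<Rightarrow> ('a, 'm) mfps" where
  "mfps_deriv j a = Abs_mfps (\<lambda>h. of_nat (h $ j + 1) * mfps_nth a (h + axis j 1))"

text \<open>\<open>H\<^sub>\<nu>\<^sub>,\<^sub>h\<close>, the coefficient of \<open>p\<^sup>h\<close> in \<open>W(p)\<^sup>\<nu>\<close>.\<close>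

definition comp_coeff ::
    "(('a :: comm_ring_1, 'm :: finite) mfps) ^ 'k \<Rightarrow> nat ^ 'k \<Rightarrow> nat ^ 'm \<Rightarrow> 'a" where
  "comp_coeff W \<nu> h = mfps_nth (\<Prod>i\<in>UNIV. (W $ i) ^ (\<nu> $ i)) h"

text \<open>The substitution \<open>a(W(p)) = \<Sum>\<^sub>\<nu> a\<^sub>\<nu> W(p)\<^sup>\<nu>\<close>. If \<open>W\<close> has zero constant term, only the finitely
  many \<open>\<nu>\<close> with \<open>|\<nu>| \<le> |h|\<close> contribute to the coefficient of \<open>p\<^sup>h\<close>. \<^const>\<open>Sum_any\<close> sums over the
  support of its argument, and is 0 if the support is infinite.\<close>

definition mfps_compose ::
    "('a :: comm_ring_1, 'k :: finite) mfps \<Rightarrow> (('a, 'm :: finite) mfps) ^ 'k \<Rightarrow> ('a, 'm) mfps" where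
  "mfps_compose a W = Abs_mfps (\<lambda>h. Sum_any (\<lambda>\<nu>. mfps_nth a \<nu> * comp_coeff W \<nu> h))"

definition vec_series :: "(nat ^ 'm \<Rightarrow> 'a ^ 'k) \<Rightarrow> (('a, 'm :: finite) mfps) ^ 'k" where
  "vec_series x = (\<chi> i. Abs_mfps (\<lambda>h. x h $ i))"

definition vec_coeff :: "(('a, 'm :: finite) mfps) ^ 'k \<Rightarrow> nat ^ 'm \<Rightarrow> 'a ^ 'k" where
  "vec_coeff X h = (\<chi> i. mfps_nth (X $ i) h)"

definition jacobian :: "(('a :: comm_ring_1, 'm :: finite) mfps) ^ 'k \<Rightarrow> (('a, 'm) mfps) ^ 'm ^ 'k" where
  "jacobian X = (\<chi> i j. mfps_deriv j (X $ i))"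

definition block_vec :: "'a ^ 'k \<Rightarrow> 'a ^ 'l \<Rightarrow> 'a ^ ('k :: finite + 'l :: finite)" where
  "block_vec x y = (\<chi> i. case i of Inl a \<Rightarrow> x $ a | Inr b \<Rightarrow> y $ b)"

definition upper_block :: "'a ^ ('k :: finite + 'l :: finite) \<Rightarrow> 'a ^ 'k" where
  "upper_block x = (\<chi> a. x $ Inl a)"

definition block_mat ::
    "'a ^ 'k ^ 'k \<Rightarrow> 'a ^ 'l ^ 'k \<Rightarrow> 'a ^ 'k ^ 'l \<Rightarrow> 'a ^ 'l ^ 'l \<Rightarrow> 'a ^ ('k + 'l) ^ ('k :: finite + 'l :: finite)" where
  "block_mat P Q S T = (\<chi> i. case i of Inl a \<Rightarrow> block_vec (P $ a) (Q $ a)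
                                     | Inr b \<Rightarrow> block_vec (S $ b) (T $ b))"

definition cmat :: "real ^ 'k ^ 'l \<Rightarrow> complex ^ 'k ^ 'l" where
  "cmat X = (\<chi> i j. complex_of_real (X $ i $ j))"

definition const_mat :: "real ^ 'k ^ 'l \<Rightarrow> ((complex, 'm :: finite) mfps) ^ 'k ^ 'l" where
  "const_mat X = (\<chi> i j. mfps_const (cmat X $ i $ j))"

definition mat_scale :: "'a :: times \<Rightarrow> 'a ^ 'k ^ 'l \<Rightarrow> 'a ^ 'k ^ 'l" where
  "mat_scale c X = (\<chi> i j. c * X $ i $ j)"

definition A_mat :: "real ^ 'n ^ 'n \<Rightarrow> real ^ 'n ^ 'n \<Rightarrow> real ^ ('n + 'n) ^ ('n :: finite + 'n)" where
  "A_mat M K = block_mat (- K) 0 0 M"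

definition B_mat :: "real ^ 'n ^ 'n \<Rightarrow> real ^ 'n ^ 'n \<Rightarrow> real ^ ('n + 'n) ^ ('n :: finite + 'n)" where
  "B_mat M C = block_mat C M M 0"

text \<open>The force \<open>f(y, y')\<close> is a vector of formal power series in the \<open>2n\<close> components of
  \<open>z = (y, y')\<close>.\<close>

definition F_series ::
    "((complex, 'n + 'n) mfps) ^ 'n \<Rightarrow> ((complex, 'n :: finite + 'n) mfps) ^ ('n + 'n)" where
  "F_series f = block_vec (- f) 0"

text \<open>The \<open>f\<^sub>\<nu>\<close> are the coefficients of the upper block of \<open>F\<close>, i.e. of \<open>-f\<close>, not of \<open>f\<close>.\<close>

definition f_coeff :: "((complex, 'n + 'n) mfps) ^ 'n \<Rightarrow> nat ^ ('n :: finite + 'n) \<Rightarrow> complex ^ 'n" where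
  "f_coeff f \<nu> = upper_block (vec_coeff (F_series f) \<nu>)"

definition W_series ::
    "(nat ^ 'm \<Rightarrow> complex ^ 'n) \<Rightarrow> (nat ^ 'm \<Rightarrow> complex ^ 'n)
      \<Rightarrow> ((complex, 'm :: finite) mfps) ^ ('n :: finite + 'n)" where
  "W_series w wd = block_vec (vec_series w) (vec_series wd)"

definition invariance_lhs ::
    "real ^ 'n ^ 'n \<Rightarrow> real ^ 'n ^ 'n \<Rightarrow> ((complex, 'm :: finite) mfps) ^ ('n :: finite + 'n)
      \<Rightarrow> ((complex, 'm) mfps) ^ 'm \<Rightarrow> ((complex, 'm) mfps) ^ ('n + 'n)" where
  "invariance_lhs M C W R = const_mat (B_mat M C) *v (jacobian W *v R)"

definition invariance_rhs ::
    "real ^ 'n ^ 'n \<Rightarrow> real ^ 'n ^ 'n \<Rightarrow> ((complex, 'n + 'n) mfps) ^ 'n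
      \<Rightarrow> ((complex, 'm :: finite) mfps) ^ ('n :: finite + 'n) \<Rightarrow> ((complex, 'm) mfps) ^ ('n + 'n)" where
  "invariance_rhs M K f W = const_mat (A_mat M K) *v W + (\<chi> i. mfps_compose (F_series f $ i) W)"

definition invariance_at ::
    "real ^ 'n ^ 'n \<Rightarrow> real ^ 'n ^ 'n \<Rightarrow> real ^ 'n ^ 'n \<Rightarrow> ((complex, 'n :: finite + 'n) mfps) ^ 'n
      \<Rightarrow> (nat ^ 'm \<Rightarrow> complex ^ 'n) \<Rightarrow> (nat ^ 'm \<Rightarrow> complex ^ 'n) \<Rightarrow> (nat ^ 'm :: finite \<Rightarrow> complex ^ 'm)
      \<Rightarrow> nat ^ 'm \<Rightarrow> bool" where
  "invariance_at M C K f w wd R m \<longleftrightarrow>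
     vec_coeff (invariance_lhs M C (W_series w wd) (vec_series R)) m
       = vec_coeff (invariance_rhs M K f (W_series w wd)) m"

definition eigenpair ::
    "real ^ 'n ^ 'n \<Rightarrow> real ^ 'n ^ 'n \<Rightarrow> real ^ 'n ^ 'n \<Rightarrow> complex \<Rightarrow> complex ^ 'n \<Rightarrow> bool" where
  "eigenpair M C K l v \<longleftrightarrow>
     v \<noteq> 0 \<and> (mat_scale (l\<^sup>2) (cmat M) + mat_scale l (cmat C) + cmat K) *v v = 0"

definition Lam :: "('m \<Rightarrow> complex) \<Rightarrow> nat ^ 'm \<Rightarrow> complex" where
  "Lam lam m = (\<Sum>j\<in>UNIV. lam j * of_nat (m $ j))"

text \<open>The pairs \<open>(u, k)\<close> with \<open>1 < |u| < |m|\<close> and \<open>u + k - e\<^sub>j = m\<close>. The last condition is meant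
  without truncation, hence the rearrangement.\<close>

definition splits :: "nat ^ 'm \<Rightarrow> 'm \<Rightarrow> ((nat ^ 'm) \<times> (nat ^ 'm)) set" where
  "splits m j = {(u, k). 1 < mdeg u \<and> mdeg u < mdeg m \<and> u + k = m + axis j 1}"

definition V_vec ::
    "(nat ^ 'm \<Rightarrow> complex ^ 'n) \<Rightarrow> (nat ^ 'm \<Rightarrow> complex ^ 'm) \<Rightarrow> nat ^ 'm \<Rightarrow> complex ^ 'n" where
  "V_vec w R m = (\<Sum>j\<in>UNIV. \<Sum>(u, k)\<in>splits m j. (of_nat (u $ j) * R k $ j) *s w u)"

definition Y_vec ::
    "real ^ 'n ^ 'n \<Rightarrow> real ^ 'n ^ 'n \<Rightarrow> ((complex, 'n + 'n) mfps) ^ 'n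
      \<Rightarrow> (nat ^ 'm \<Rightarrow> complex ^ 'n :: finite) \<Rightarrow> (nat ^ 'm \<Rightarrow> complex ^ 'n) \<Rightarrow> (nat ^ 'm \<Rightarrow> complex ^ 'm)
      \<Rightarrow> nat ^ 'm :: finite \<Rightarrow> complex ^ 'n" where
  "Y_vec M C f w wd R m =
     (\<Sum>j\<in>UNIV. \<Sum>(u, k)\<in>splits m j. (of_nat (u $ j) * R k $ j) *s (cmat M *v wd u))
     + cmat C *v V_vec w R m
     - Sum_any (\<lambda>\<nu>. comp_coeff (W_series w wd) \<nu> m *s f_coeff f \<nu>)"

definition C_vec ::
    "real ^ 'n ^ 'n \<Rightarrow> real ^ 'n ^ 'n \<Rightarrow> ((complex, 'n + 'n) mfps) ^ 'n \<Rightarrow> ('m \<Rightarrow> complex)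
      \<Rightarrow> (nat ^ 'm \<Rightarrow> complex ^ 'n :: finite) \<Rightarrow> (nat ^ 'm \<Rightarrow> complex ^ 'n) \<Rightarrow> (nat ^ 'm \<Rightarrow> complex ^ 'm)
      \<Rightarrow> nat ^ 'm :: finite \<Rightarrow> complex ^ 'n" where
  "C_vec M C f lam w wd R m =
     - (Lam lam m *s (cmat M *v V_vec w R m)) - Y_vec M C f w wd R m"

definition D_mat ::
    "real ^ 'n ^ 'n \<Rightarrow> real ^ 'n ^ 'n \<Rightarrow> ('m \<Rightarrow> complex) \<Rightarrow> ('m \<Rightarrow> complex ^ 'n) \<Rightarrow> nat ^ 'm
      \<Rightarrow> complex ^ 'm ^ 'n" where
  "D_mat M C lam \<phi> m =
     transpose (\<chi> j. - ((mat_scale (Lam lam m + lam j) (cmat M) + cmat C) *v \<phi> j))"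

end

theory Submission
  imports Defs
begin

text \<open>
  In the coefficient of \<open>p\<^sup>m\<close> of the invariance equation the unknowns \<open>w\<^sub>m\<close>, \<open>w'\<^sub>m\<close> and \<open>R\<^sub>m\<close> occur
  only linearly, and \<open>w'\<^sub>m\<close> can be eliminated with the lower block.

  On the left, the coefficient of \<open>(DW) R\<close> is the sum over \<open>j\<close> and over \<open>u + k = m + e\<^sub>j\<close> of
  \<open>u\<^sub>j R\<^sup>j\<^sub>k W\<^sub>u\<close>.  The terms with \<open>|u| = |m|\<close> collapse to \<open>\<Lambda>\<^sub>m W\<^sub>m\<close> since the linear part of \<open>R\<close> is
  diagonal, those with \<open>|u| = 1\<close> collapse to \<open>\<Sum>\<^sub>j R\<^sup>j\<^sub>m W\<close> at \<open>e\<^sub>j\<close>, and what remains is the sum in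
  \<open>V\<^sub>m\<close>, which involves lower orders only (\<open>jacobian_mult_coeff\<close>, \<open>V_vec_upd\<close>).

  On the right, \<open>F\<close> has only terms of degree at least two and \<open>W\<close> has no constant term, so the
  coefficient of \<open>F(W(p))\<close> depends on lower orders only as well (\<open>comp_coeff_cong\<close>).

  Put \<open>v = \<Lambda>\<^sub>m w\<^sub>m + \<Sum>\<^sub>j R\<^sup>j\<^sub>m \<phi>\<^sub>j + V\<^sub>m\<close>.  The lower block of the equation reads \<open>M v = M w'\<^sub>m\<close>.  It is
  solvable, by \<open>w'\<^sub>m = v\<close>; and whichever solution is taken, the upper block contains \<open>w'\<^sub>m\<close> only in the
  term \<open>\<Lambda>\<^sub>m M w'\<^sub>m\<close>, which equals \<open>\<Lambda>\<^sub>m M v\<close>.  Collecting the factors of \<open>w\<^sub>m\<close> and \<open>R\<^sub>m\<close> gives the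
  linear system.
\<close>

section \<open>Multi-indices by total degree\<close>

lemma mdeg_0 [simp]: "mdeg (0 :: nat ^ 'm :: finite) = 0"
  by (simp add: mdeg_def)

lemma mdeg_add: "mdeg (u + k) = mdeg u + mdeg (k :: nat ^ 'm :: finite)"
  by (simp add: mdeg_def sum.distrib)

lemma mdeg_axis [simp]: "mdeg (axis j c :: nat ^ 'm :: finite) = c"
  by (simp add: mdeg_def axis_def)

lemma mdeg_eq_0D: "mdeg (u :: nat ^ 'm :: finite) = 0 \<Longrightarrow> u = 0"
  by (simp add: mdeg_def vec_eq_iff)

lemma mdeg_eq_1D:
  fixes u :: "nat ^ 'm :: finite"
  assumes "mdeg u = 1"
  obtains i where "u = axis i 1"
proof -
  obtain i where i: "u $ i = 1" "\<forall>j. j \<noteq> i \<longrightarrow> u $ j = 0"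
    using assms by (auto simp: mdeg_def sum_eq_Suc0_iff)
  then have "u = axis i 1"
    by (auto simp: vec_eq_iff axis_def)
  then show thesis by (rule that)
qed

lemma finite_mdeg_le: "finite {\<nu> :: nat ^ 'k :: finite. mdeg \<nu> \<le> d}"
proof -
  have "{\<nu> :: nat ^ 'k. mdeg \<nu> \<le> d} \<subseteq> fst ` {(u, k). u + k = (\<chi> i. d)}"
  proof
    fix \<nu> :: "nat ^ 'k" assume "\<nu> \<in> {\<nu>. mdeg \<nu> \<le> d}"
    then have "\<nu> $ i \<le> d" for i
      using member_le_sum[of i UNIV "\<lambda>i. \<nu> $ i"] by (simp add: mdeg_def)
    then have "(\<nu>, \<chi> i. d - \<nu> $ i) \<in> {(u, k). u + k = (\<chi> i. d)}"
      by (simp add: vec_eq_iff)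
    then show "\<nu> \<in> fst ` {(u, k). u + k = (\<chi> i. d)}"
      by force
  qed
  then show ?thesis
    using finite_multiindex_splits finite_subset by blast
qed

section \<open>Coefficients of formal power series\<close>

lemma mfps_nth_0 [simp]: "mfps_nth 0 h = 0"
  by (simp add: zero_mfps_def)

lemma mfps_nth_add [simp]: "mfps_nth (a + b) h = mfps_nth a h + mfps_nth b h"
  by (simp add: plus_mfps_def)

lemma mfps_nth_diff [simp]: "mfps_nth (a - b) h = mfps_nth a h - mfps_nth b h"
  by (simp add: minus_mfps_def)

lemma mfps_nth_mult:
  "mfps_nth (a * b) h = (\<Sum>(u, k)\<in>{(u, k). u + k = h}. mfps_nth a u * mfps_nth b k)"
  by (simp add: times_mfps_def)

lemma mfps_nth_sum: "mfps_nth (sum g S) h = (\<Sum>i\<in>S. mfps_nth (g i) h)"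
  by (induction S rule: infinite_finite_induct) simp_all

lemma mfps_nth_const_mult:
  "mfps_nth (mfps_const c * a) h = c * mfps_nth (a :: ('a :: comm_ring_1, 'm :: finite) mfps) h"
proof -
  have "mfps_nth (mfps_const c * a) h =
      (\<Sum>p\<in>{(u, k). u + k = h}. if p = (0, h) then c * mfps_nth a h else 0)"
    unfolding mfps_nth_mult by (rule sum.cong) (auto simp: mfps_const_def split: if_splits)
  also have "\<dots> = c * mfps_nth a h"
    using finite_multiindex_splits[of h] by (subst sum.delta) auto
  finally show ?thesis .
qed

text \<open>The derivative lowers the \<open>j\<close>-th exponent, which re-indexes the Cauchy product by
  \<open>u \<mapsto> u + e\<^sub>j\<close>; the multi-indices \<open>u\<close> with \<open>u\<^sub>j = 0\<close> that are missed carry the factor \<open>u\<^sub>j\<close>.\<close>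

lemma mfps_nth_deriv_mult:
  fixes a r :: "('a :: comm_ring_1, 'm :: finite) mfps"
  shows "mfps_nth (mfps_deriv j a * r) m =
    (\<Sum>(u, k)\<in>{(u, k). u + k = m + axis j 1}. of_nat (u $ j) * mfps_nth r k * mfps_nth a u)"
    (is "_ = sum ?g ?S")
proof -
  let ?T = "{(u, k). u + k = m + axis j 1 \<and> u $ j \<noteq> 0}"
  have lower: "u - axis j 1 + axis j 1 = u" if "u $ j \<noteq> 0" for u :: "nat ^ 'm"
    using that by (auto simp: vec_eq_iff axis_def)
  have "mfps_nth (mfps_deriv j a * r) m = sum ?g ?T"
    unfolding mfps_nth_mult
  proof (rule sum.reindex_bij_witness
      [of _ "\<lambda>(u, k). (u - axis j 1, k)" "\<lambda>(u, k). (u + axis j 1, k)"], goal_cases)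
    case (4 p)
    then show ?case
    proof (clarsimp)
      fix u k :: "nat ^ 'm"
      assume eq: "u + k = m + axis j (Suc 0)" and "0 < u $ j"
      then have "u - axis j 1 + k + axis j 1 = m + axis j 1"
        using lower[of u] by (metis One_nat_def add.assoc add.commute neq0_conv)
      then show "u - axis j (Suc 0) + k = m" by simp
    qed
  qed (use lower in \<open>auto simp: mfps_deriv_def algebra_simps axis_def\<close>)
  also have "\<dots> = sum ?g ?S"
    by (rule sum.mono_neutral_left) (auto simp: finite_multiindex_splits intro!: gr0I)
  finally show ?thesis .
qed

text \<open>A term of degree \<open>|m|\<close> in \<open>(\<partial>\<^sub>j a) r\<close> pairs \<open>a\<^sub>u\<close> with \<open>r\<^sub>k\<close> where \<open>|u| + |k| = |m| + 1\<close>.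
  In the two extreme degrees \<open>|u| = 1\<close> and \<open>|k| = 1\<close> only \<open>u = e\<^sub>j\<close> (because of the factor \<open>u\<^sub>j\<close>)
  and \<open>k = e\<^sub>j\<close> (because \<open>r\<close> has linear part proportional to \<open>p\<^sub>j\<close>) survive. They produce the two
  terms in which the coefficients of order \<open>m\<close> occur.\<close>

lemma mfps_nth_deriv_mult_split:
  fixes a r :: "('a :: comm_ring_1, 'm :: finite) mfps"
  assumes r0: "mfps_nth r 0 = 0"
    and r1: "\<And>i. i \<noteq> j \<Longrightarrow> mfps_nth r (axis i 1) = 0"
    and m: "mdeg m \<ge> 2"
  shows "mfps_nth (mfps_deriv j a * r) m =
    of_nat (m $ j) * mfps_nth r (axis j 1) * mfps_nth a m
    + mfps_nth r m * mfps_nth a (axis j 1)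
    + (\<Sum>(u, k)\<in>splits m j. of_nat (u $ j) * mfps_nth r k * mfps_nth a u)"
proof -
  let ?g = "\<lambda>(u, k). of_nat (u $ j) * mfps_nth r k * mfps_nth a u"
  let ?S = "{(u, k). u + k = m + axis j 1}"
  let ?T = "insert (m, axis j 1) (insert (axis j 1, m) (splits m j))"
  have fin: "finite (splits m j)"
    by (rule finite_subset[OF _ finite_multiindex_splits[of "m + axis j 1"]])
      (auto simp: splits_def)
  have "sum ?g ?S = sum ?g ?T"
  proof (rule sum.mono_neutral_right)
    show "\<forall>p\<in>?S - ?T. ?g p = 0"
    proof
      fix p assume p: "p \<in> ?S - ?T"
      obtain u k where uk: "p = (u, k)" by (cases p)
      then have eq: "u + k = m + axis j 1" and notin: "(u, k) \<notin> ?T"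
        using p by auto
      have deg: "mdeg u + mdeg k = mdeg m + 1"
        using arg_cong[OF eq, of mdeg] by (simp add: mdeg_add)
      have "\<not> (1 < mdeg u \<and> mdeg u < mdeg m)"
        using eq notin by (auto simp: splits_def)
      then consider "mdeg u = 0" | "mdeg u = 1" | "mdeg k = 0" | "mdeg k = 1"
        using deg by linarith
      then have "of_nat (u $ j) * mfps_nth r k * mfps_nth a u = 0"
      proof cases
        case 1
        then show ?thesis by (auto dest: mdeg_eq_0D)
      next
        case 2
        then obtain i where i: "u = axis i 1" by (rule mdeg_eq_1D)
        have "i \<noteq> j"
          using eq notin i by (auto simp: add.commute)
        then show ?thesis using i by (simp add: axis_def)
      next
        case 3
        then show ?thesis using r0 by (auto dest: mdeg_eq_0D)
      next
        case 4
        then obtain i where i: "k = axis i 1" by (rule mdeg_eq_1D)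
        have "i \<noteq> j"
          using eq notin i by auto
        then show ?thesis using i r1 by simp
      qed
      then show "?g p = 0" using uk by simp
    qed
  qed (auto simp: finite_multiindex_splits splits_def add.commute)
  moreover have "(m, axis j 1) \<noteq> (axis j 1, m)"
    using m by auto
  moreover have "(m, axis j 1) \<notin> splits m j" "(axis j 1, m) \<notin> splits m j"
    by (auto simp: splits_def)
  ultimately show ?thesis
    using fin by (simp add: mfps_nth_deriv_mult axis_def add.assoc)
qed

section \<open>Order of vanishing and composition coefficients\<close>

definition vanishes_below :: "nat \<Rightarrow> ('a :: comm_ring_1, 'm :: finite) mfps \<Rightarrow> bool" where
  "vanishes_below d a \<longleftrightarrow> (\<forall>h. mdeg h < d \<longrightarrow> mfps_nth a h = 0)"

lemma vanishes_below_add: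
  "vanishes_below d a \<Longrightarrow> vanishes_below d b \<Longrightarrow> vanishes_below d (a + b)"
  by (simp add: vanishes_below_def)

lemma vanishes_below_mult:
  assumes "vanishes_below d a" "vanishes_below e b"
  shows "vanishes_below (d + e) (a * b)"
  unfolding vanishes_below_def mfps_nth_mult
proof (intro allI impI sum.neutral ballI, clarify)
  fix u k :: "nat ^ 'b" assume "mdeg (u + k) < d + e"
  then have "mdeg u < d \<or> mdeg k < e"
    by (auto simp: mdeg_add)
  then show "mfps_nth a u * mfps_nth b k = 0"
    using assms by (auto simp: vanishes_below_def)
qed

text \<open>A relation between a product and its perturbation that is stable under multiplication: orders
  of vanishing \<open>d\<close> add up, whereas the gap \<open>D\<close> between the order of vanishing and the order at which
  the two products start to differ stays the same.\<close>

definition agree_to :: "nat \<Rightarrow> nat \<Rightarrow> ('a :: comm_ring_1, 'm :: finite) mfps \<Rightarrow> ('a, 'm) mfps \<Rightarrow> bool"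
  where "agree_to D d a b \<longleftrightarrow>
    vanishes_below d a \<and> vanishes_below d b \<and> vanishes_below (d + D) (a - b)"

lemma agree_to_1: "agree_to D 0 1 1"
  by (simp add: agree_to_def vanishes_below_def)

text \<open>This is the product rule \<open>a a' - b b' = (a - b) a' + b (a' - b')\<close>.\<close>

lemma agree_to_mult:
  assumes "agree_to D d a b" "agree_to D e a' b'"
  shows "agree_to D (d + e) (a * a') (b * b')"
proof -
  have "vanishes_below (d + D + e) ((a - b) * a')" "vanishes_below (d + (e + D)) (b * (a' - b'))"
    using assms by (auto simp: agree_to_def intro!: vanishes_below_mult)
  then have "vanishes_below (d + e + D) ((a - b) * a' + b * (a' - b'))"
    by (intro vanishes_below_add) (simp_all add: ac_simps)
  then show ?thesis
    using assms by (simp add: agree_to_def vanishes_below_mult algebra_simps)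
qed

lemma agree_to_power: "agree_to D d a b \<Longrightarrow> agree_to D (n * d) (a ^ n) (b ^ n)"
  by (induction n) (simp_all add: agree_to_1 agree_to_mult)

lemma agree_to_prod:
  assumes "\<And>i. i \<in> S \<Longrightarrow> agree_to D (d i) (a i) (b i)"
  shows "agree_to D (sum d S) (prod a S) (prod b S)"
  using assms by (induction S rule: infinite_finite_induct) (simp_all add: agree_to_1 agree_to_mult)

lemma agree_to_monomial:
  fixes W W' :: "('a :: comm_ring_1, 'm :: finite) mfps ^ 'k :: finite"
  assumes "\<And>i. agree_to D 1 (W $ i) (W' $ i)"
  shows "agree_to D (mdeg \<nu>) (\<Prod>i\<in>UNIV. (W $ i) ^ (\<nu> $ i)) (\<Prod>i\<in>UNIV. (W' $ i) ^ (\<nu> $ i))"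
  unfolding mdeg_def
  by (rule agree_to_prod) (use agree_to_power[OF assms] in simp)

text \<open>\<open>W\<^sup>\<nu>\<close> has order at least \<open>|\<nu>|\<close>, as the comparison of \<open>W\<close> with itself shows.\<close>

lemma comp_coeff_eq_0:
  fixes W :: "('a :: comm_ring_1, 'm :: finite) mfps ^ 'k :: finite"
  assumes "\<And>i. mfps_nth (W $ i) 0 = 0" and "mdeg h < mdeg \<nu>"
  shows "comp_coeff W \<nu> h = 0"
proof -
  have "agree_to 0 1 (W $ i) (W $ i)" for i
    using assms(1) by (auto simp: agree_to_def vanishes_below_def dest: mdeg_eq_0D)
  from agree_to_monomial[of 0 W W \<nu>, OF this] show ?thesis
    using assms(2) by (simp add: agree_to_def vanishes_below_def comp_coeff_def)
qed

text \<open>In a product of at least two factors without constant term, a coefficient of degree \<open>|m|\<close> of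
  one factor is multiplied by something of degree at least 1, so it cannot contribute to the
  coefficient of \<open>p\<^sup>m\<close>.\<close>

lemma comp_coeff_cong:
  fixes W W' :: "('a :: comm_ring_1, 'm :: finite) mfps ^ 'k :: finite"
  assumes "\<And>i. mfps_nth (W $ i) 0 = 0"
    and "\<And>i h. mdeg h < mdeg m \<Longrightarrow> mfps_nth (W' $ i) h = mfps_nth (W $ i) h"
    and m: "mdeg m \<ge> 1" and \<nu>: "mdeg \<nu> \<ge> 2"
  shows "comp_coeff W' \<nu> m = comp_coeff W \<nu> m"
proof -
  have "agree_to (mdeg m - 1) 1 (W' $ i) (W $ i)" for i
    using assms(1)[of i] assms(2)[of _ i] m
    by (auto simp: agree_to_def vanishes_below_def dest!: mdeg_eq_0D)
  from agree_to_monomial[of "mdeg m - 1" W' W \<nu>, OF this] show ?thesis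
    using m \<nu> by (simp add: agree_to_def vanishes_below_def comp_coeff_def)
qed

section \<open>Coefficients of vector-valued series and their block structure\<close>

lemma vec_coeff_const_mat_mult:
  "vec_coeff (const_mat X *v Z) h = cmat X *v vec_coeff Z h"
  by (simp add: vec_coeff_def const_mat_def matrix_vector_mult_def vec_eq_iff
      mfps_nth_sum mfps_nth_const_mult)

lemma vec_coeff_block_vec: "vec_coeff (block_vec X Y) h = block_vec (vec_coeff X h) (vec_coeff Y h)"
  by (simp add: vec_coeff_def block_vec_def vec_eq_iff split: sum.split)

lemma vec_coeff_vec_series [simp]: "vec_coeff (vec_series x) h = x h"
  by (simp add: vec_coeff_def vec_series_def vec_eq_iff)

lemma block_vec_eq_iff: "block_vec a b = block_vec c d \<longleftrightarrow> a = c \<and> b = d"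
  by (auto simp: block_vec_def vec_eq_iff split: sum.split)

lemma block_vec_add: "block_vec a b + block_vec c d = block_vec (a + c) (b + d)"
  by (auto simp: block_vec_def vec_eq_iff split: sum.split)

lemma jacobian_block_vec_mult:
  "jacobian (block_vec X Y) *v R = block_vec (jacobian X *v R) (jacobian Y *v R)"
  by (auto simp: jacobian_def matrix_vector_mult_def block_vec_def vec_eq_iff split: sum.split)

lemma sum_UNIV_Plus:
  "(\<Sum>i\<in>UNIV. g i) = (\<Sum>a\<in>UNIV. g (Inl a)) + (\<Sum>b\<in>UNIV. g (Inr b))"
  for g :: "'k :: finite + 'l :: finite \<Rightarrow> 'a :: comm_monoid_add"
  by (subst UNIV_Plus_UNIV[symmetric], subst sum.Plus) simp_all

lemma cmat_block_mat_mult: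
  "cmat (block_mat P Q S T) *v block_vec x y =
    block_vec (cmat P *v x + cmat Q *v y) (cmat S *v x + cmat T *v y)"
  by (auto simp: cmat_def block_mat_def matrix_vector_mult_def block_vec_def vec_eq_iff
      sum_UNIV_Plus split: sum.split)

lemma cmat_0: "cmat 0 = 0" and cmat_uminus: "cmat (- X) = - cmat X"
  by (simp_all add: cmat_def vec_eq_iff)

lemma mat_scale_mult_vec: "mat_scale c X *v x = c *s (X *v x)"
  for X :: "'a :: comm_semiring_1 ^ 'k ^ 'l"
  by (simp add: mat_scale_def matrix_vector_mult_def vec_eq_iff sum_distrib_left mult.assoc)

lemma matrix_vector_mult_sum: "A *v (\<Sum>i\<in>S. x i) = (\<Sum>i\<in>S. A *v x i)"
  for A :: "complex ^ 'k ^ 'l"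
  by (induction S rule: infinite_finite_induct) (simp_all add: matrix_vector_right_distrib)

text \<open>Here \<open>x\<close> stands for either block of \<open>W\<close>.\<close>

lemma jacobian_mult_coeff:
  fixes x :: "nat ^ 'm \<Rightarrow> complex ^ 'k :: finite" and R :: "nat ^ 'm \<Rightarrow> complex ^ 'm :: finite"
  assumes "R 0 = 0" and "\<And>i j. R (axis j 1) $ i = (if i = j then lam j else 0)"
    and "mdeg m \<ge> 2"
  shows "vec_coeff (jacobian (vec_series x) *v vec_series R) m =
    Lam lam m *s x m + (\<Sum>j\<in>UNIV. R m $ j *s x (axis j 1)) + V_vec x R m"
proof -
  have "mfps_nth (\<Sum>j\<in>UNIV. mfps_deriv j (vec_series x $ i) * vec_series R $ j) m =
    (\<Sum>j\<in>UNIV. of_nat (m $ j) * lam j * x m $ i + R m $ j * x (axis j 1) $ i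
      + (\<Sum>(u, k)\<in>splits m j. of_nat (u $ j) * R k $ j * x u $ i))" for i
    unfolding mfps_nth_sum
    by (rule sum.cong[OF refl], subst mfps_nth_deriv_mult_split)
      (use assms in \<open>simp_all add: vec_series_def\<close>)
  then show ?thesis
    by (simp add: vec_coeff_def jacobian_def matrix_vector_mult_def vec_eq_iff V_vec_def Lam_def
        sum.distrib sum_distrib_left case_prod_unfold mult_ac)
qed

text \<open>Only finitely many \<open>\<nu>\<close> contribute, so the infinite sums defining the composition may be taken
  over a common finite set and hence componentwise.\<close>

lemma Sum_any_comp_coeff:
  fixes W :: "('a :: comm_ring_1, 'm :: finite) mfps ^ 'k :: finite"
  assumes W0: "\<And>i. mfps_nth (W $ i) 0 = 0" and g0: "\<And>\<nu>. comp_coeff W \<nu> m = 0 \<Longrightarrow> g \<nu> = 0"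
  shows "Sum_any g = sum g {\<nu>. mdeg \<nu> \<le> mdeg m}"
  using comp_coeff_eq_0[OF W0, of m]
  by (intro Sum_any.expand_superset finite_mdeg_le) (force intro: g0 simp: not_less)

lemma vec_coeff_compose_F:
  fixes W :: "(complex, 'm :: finite) mfps ^ ('n :: finite + 'n)"
  assumes "\<And>i. mfps_nth (W $ i) 0 = 0"
  shows "vec_coeff (\<chi> i. mfps_compose (F_series f $ i) W) m =
    block_vec (Sum_any (\<lambda>\<nu>. comp_coeff W \<nu> m *s f_coeff f \<nu>)) 0"
proof -
  let ?T = "{\<nu> :: nat ^ ('n + 'n). mdeg \<nu> \<le> mdeg m}"
  have scalar: "Sum_any (\<lambda>\<nu>. mfps_nth a \<nu> * comp_coeff W \<nu> m)
      = (\<Sum>\<nu>\<in>?T. comp_coeff W \<nu> m * mfps_nth a \<nu>)" for a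
    by (subst Sum_any_comp_coeff[OF assms]) (simp_all add: mult.commute)
  have vector: "Sum_any (\<lambda>\<nu>. comp_coeff W \<nu> m *s f_coeff f \<nu>)
      = (\<Sum>\<nu>\<in>?T. comp_coeff W \<nu> m *s f_coeff f \<nu>)"
    by (rule Sum_any_comp_coeff[OF assms]) simp
  show ?thesis
    unfolding vector
    by (simp add: vec_eq_iff vec_coeff_def mfps_compose_def scalar F_series_def f_coeff_def
        upper_block_def block_vec_def split: sum.split)
qed

section \<open>Elimination of the velocity coefficient\<close>

lemma Sum_any_force_cong:
  fixes W W' :: "(complex, 'm :: finite) mfps ^ ('n :: finite + 'n)"
  assumes f: "\<And>\<nu>. mdeg \<nu> \<le> 1 \<Longrightarrow> vec_coeff f \<nu> = 0"
    and W0: "\<And>i. mfps_nth (W $ i) 0 = 0"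
    and W': "\<And>i h. mdeg h < mdeg m \<Longrightarrow> mfps_nth (W' $ i) h = mfps_nth (W $ i) h"
    and m: "mdeg m \<ge> 1"
  shows "Sum_any (\<lambda>\<nu>. comp_coeff W' \<nu> m *s f_coeff f \<nu>)
    = Sum_any (\<lambda>\<nu>. comp_coeff W \<nu> m *s f_coeff f \<nu>)"
proof (rule Sum_any.cong)
  fix \<nu> :: "nat ^ ('n + 'n)"
  show "comp_coeff W' \<nu> m *s f_coeff f \<nu> = comp_coeff W \<nu> m *s f_coeff f \<nu>"
  proof (cases "mdeg \<nu> \<le> 1")
    case True
    from f[OF True] have "f_coeff f \<nu> = 0"
      by (simp add: f_coeff_def upper_block_def F_series_def vec_coeff_def block_vec_def
          vec_eq_iff uminus_mfps_def)
    then show ?thesis by simp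
  next
    case False
    then show ?thesis
      using comp_coeff_cong[OF W0 W' m, of \<nu>] by simp
  qed
qed

text \<open>The restriction \<open>1 < |u| < |m|\<close> keeps both \<open>|u|\<close> and \<open>|k| = |m| + 1 - |u|\<close> below \<open>|m|\<close>.\<close>

lemma V_vec_upd: "V_vec (x(m := a)) (R(m := b)) m = V_vec x R m"
proof -
  have "u \<noteq> m \<and> k \<noteq> m" if "(u, k) \<in> splits m j" for u k j
  proof -
    have "mdeg u + mdeg k = mdeg m + 1" "1 < mdeg u" "mdeg u < mdeg m"
      using that by (auto simp: splits_def simp flip: mdeg_add)
       (simp add: mdeg_add)
    then show ?thesis by auto
  qed
  then show ?thesis
    unfolding V_vec_def by (intro sum.cong refl) auto
qed

text \<open>The explicit double sum in \<open>Y\<^sub>m\<close> is the sum \<open>V\<^sub>m\<close> formed with the velocity coefficients.\<close>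

lemma Y_vec_eq:
  "Y_vec M C f w wd R m = cmat M *v V_vec wd R m + cmat C *v V_vec w R m
     - Sum_any (\<lambda>\<nu>. comp_coeff (W_series w wd) \<nu> m *s f_coeff f \<nu>)"
  by (simp add: Y_vec_def V_vec_def matrix_vector_mult_sum case_prod_unfold vector_scalar_commute)

lemma D_mat_mult:
  "D_mat M C lam \<phi> m *v r =
    - (\<Sum>j\<in>UNIV. r $ j *s ((Lam lam m + lam j) *s (cmat M *v \<phi> j) + cmat C *v \<phi> j))"
proof -
  have "column j (D_mat M C lam \<phi> m) =
      - ((Lam lam m + lam j) *s (cmat M *v \<phi> j) + cmat C *v \<phi> j)" for j
    by (simp add: D_mat_def column_transpose row_def vec_eq_iff mat_scale_mult_vec
        matrix_vector_mult_add_rdistrib)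
  then show ?thesis
    by (simp only: matrix_mult_sum[of "D_mat M C lam \<phi> m" r] vector_smult_rneg sum_negf)
qed

text \<open>The two conjuncts are the upper and the lower block of the equation.\<close>

lemma invariance_at_iff:
  fixes M C K :: "real ^ 'n ^ 'n :: finite" and R :: "nat ^ 'm \<Rightarrow> complex ^ 'm :: finite"
  assumes "w 0 = 0" "wd 0 = 0" "R 0 = 0"
    and "\<And>i j. R (axis j 1) $ i = (if i = j then lam j else 0)"
    and "mdeg m \<ge> 2"
  shows "invariance_at M C K f w wd R m \<longleftrightarrow>
    cmat C *v (Lam lam m *s w m + (\<Sum>j\<in>UNIV. R m $ j *s w (axis j 1)) + V_vec w R m)
    + cmat M *v (Lam lam m *s wd m + (\<Sum>j\<in>UNIV. R m $ j *s wd (axis j 1)) + V_vec wd R m)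
    = - (cmat K *v w m) + Sum_any (\<lambda>\<nu>. comp_coeff (W_series w wd) \<nu> m *s f_coeff f \<nu>)
    \<and> cmat M *v (Lam lam m *s w m + (\<Sum>j\<in>UNIV. R m $ j *s w (axis j 1)) + V_vec w R m)
    = cmat M *v wd m"
proof -
  have W0: "mfps_nth (W_series w wd $ i) 0 = 0" for i
    using assms(1,2) by (simp add: W_series_def block_vec_def vec_series_def split: sum.split)
  have add: "vec_coeff (X + Y) m = vec_coeff X m + vec_coeff Y m"
    for X Y :: "(complex, 'm) mfps ^ ('n + 'n)"
    by (simp add: vec_coeff_def vec_eq_iff)
  have lhs: "vec_coeff (invariance_lhs M C (W_series w wd) (vec_series R)) m
    = cmat (block_mat C M M 0) *v
      block_vec (Lam lam m *s w m + (\<Sum>j\<in>UNIV. R m $ j *s w (axis j 1)) + V_vec w R m)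
       (Lam lam m *s wd m + (\<Sum>j\<in>UNIV. R m $ j *s wd (axis j 1)) + V_vec wd R m)"
    unfolding invariance_lhs_def vec_coeff_const_mat_mult W_series_def jacobian_block_vec_mult
      vec_coeff_block_vec B_mat_def
    by (simp only: jacobian_mult_coeff[OF assms(3-5)])
  have rhs: "vec_coeff (invariance_rhs M K f (W_series w wd)) m
    = cmat (block_mat (- K) 0 0 M) *v block_vec (w m) (wd m)
      + block_vec (Sum_any (\<lambda>\<nu>. comp_coeff (W_series w wd) \<nu> m *s f_coeff f \<nu>)) 0"
    unfolding invariance_rhs_def add vec_coeff_const_mat_mult vec_coeff_compose_F[OF W0] A_mat_def
    by (simp add: W_series_def vec_coeff_block_vec)
  have neg: "- cmat K *v w m = - (cmat K *v w m)"
    by (simp add: matrix_vector_mult_def vec_eq_iff sum_negf)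
  show ?thesis
    unfolding invariance_at_def lhs rhs
    by (simp add: cmat_block_mat_mult block_vec_add block_vec_eq_iff cmat_0 cmat_uminus neg)
qed

theorem lemma1:
  fixes M C K :: "real ^ 'n ^ 'n"
    and f :: "((complex, 'n + 'n) mfps) ^ 'n"
    and lam :: "'m :: finite \<Rightarrow> complex"
    and \<phi> :: "'m \<Rightarrow> complex ^ 'n"
    and w wd :: "nat ^ 'm \<Rightarrow> complex ^ 'n"
    and R :: "nat ^ 'm \<Rightarrow> complex ^ 'm"
    and m :: "nat ^ 'm"
  assumes f_nonlinear: "\<And>\<nu>. mdeg \<nu> \<le> 1 \<Longrightarrow> vec_coeff f \<nu> = 0"
    and even_dim: "even CARD('m)"
    and conj_closed: "\<And>j. \<exists>i. lam i = cnj (lam j)"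
    and eigen: "\<And>j. eigenpair M C K (lam j) (\<phi> j)"
    and order0: "w 0 = 0" "wd 0 = 0" "R 0 = 0"
    and order1_w: "\<And>j. w (axis j 1) = \<phi> j"
    and order1_wd: "\<And>j. wd (axis j 1) = lam j *s \<phi> j"
    and order1_R: "\<And>i j. R (axis j 1) $ i = (if i = j then lam j else 0)"
    and order_m: "mdeg m \<ge> 2"
  shows "\<forall>w\<^sub>m R\<^sub>m.
    (\<exists>wd\<^sub>m. invariance_at M C K f (w(m := w\<^sub>m)) (wd(m := wd\<^sub>m)) (R(m := R\<^sub>m)) m)
    \<longleftrightarrow> (cmat K + mat_scale (Lam lam m) (cmat C) + mat_scale ((Lam lam m)\<^sup>2) (cmat M)) *v w\<^sub>m
          = D_mat M C lam \<phi> m *v R\<^sub>m + C_vec M C f lam w wd R m"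
proof (intro allI)
  fix w\<^sub>m :: "complex ^ 'n" and R\<^sub>m :: "complex ^ 'm"
  let ?L = "Lam lam m" and ?M = "cmat M" and ?C = "cmat C"
  let ?S = "Sum_any (\<lambda>\<nu>. comp_coeff (W_series w wd) \<nu> m *s f_coeff f \<nu>)"
  let ?P = "\<Sum>j\<in>UNIV. R\<^sub>m $ j *s \<phi> j"
  let ?Q = "\<Sum>j\<in>UNIV. R\<^sub>m $ j *s (lam j *s \<phi> j)"
  let ?V = "V_vec w R m" and ?Vd = "V_vec wd R m"
  define v where "v = ?L *s w\<^sub>m + ?P + ?V"
  have m0: "m \<noteq> 0" and m1: "\<And>j. axis j 1 \<noteq> m"
    using order_m by auto
  have W: "mfps_nth (W_series (w(m := w\<^sub>m)) (wd(m := x)) $ i) h = mfps_nth (W_series w wd $ i) h"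
    if "mdeg h < mdeg m" for x i h
    using that by (auto simp: W_series_def block_vec_def vec_series_def split: sum.split)
  have W0: "mfps_nth (W_series w wd $ i) 0 = 0" for i
    using order0 by (simp add: W_series_def block_vec_def vec_series_def split: sum.split)
  have S: "Sum_any (\<lambda>\<nu>. comp_coeff (W_series (w(m := w\<^sub>m)) (wd(m := x))) \<nu> m *s f_coeff f \<nu>) = ?S"
    for x
    using order_m by (intro Sum_any_force_cong f_nonlinear W0 W) auto
  have inv: "invariance_at M C K f (w(m := w\<^sub>m)) (wd(m := x)) (R(m := R\<^sub>m)) m \<longleftrightarrow>
      ?C *v v + ?M *v (?L *s x + ?Q + ?Vd) = - (cmat K *v w\<^sub>m) + ?S \<and> ?M *v v = ?M *v x" for x
  proof -
    have upd: "(w(m := w\<^sub>m)) 0 = 0" "(wd(m := x)) 0 = 0" "(R(m := R\<^sub>m)) 0 = 0"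
      "(R(m := R\<^sub>m)) (axis j 1) $ i = (if i = j then lam j else 0)" for i j
      using m0 m1 order0 order1_R by auto
    show ?thesis
      unfolding invariance_at_iff[of "w(m := w\<^sub>m)" "wd(m := x)" "R(m := R\<^sub>m)" lam, OF upd order_m] S V_vec_upd v_def
      using m1 by (simp add: order1_w[simplified] order1_wd[simplified])
  qed
  \<comment> \<open>The mass matrix may be singular, so \<open>x\<close> need not be \<open>v\<close>; but only \<open>?M *v x\<close> enters the upper
    block, and \<open>v\<close> itself is a witness.\<close>
  have "(\<exists>x. invariance_at M C K f (w(m := w\<^sub>m)) (wd(m := x)) (R(m := R\<^sub>m)) m) \<longleftrightarrow>
      ?C *v v + (?L *s (?M *v v) + ?M *v ?Q + ?M *v ?Vd) = - (cmat K *v w\<^sub>m) + ?S"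
    unfolding inv by (auto simp: matrix_vector_right_distrib vector_scalar_commute)
  also have "\<dots> \<longleftrightarrow> (cmat K + mat_scale ?L ?C + mat_scale (?L\<^sup>2) ?M) *v w\<^sub>m
      = D_mat M C lam \<phi> m *v R\<^sub>m + C_vec M C f lam w wd R m"
  proof -
    have D: "D_mat M C lam \<phi> m *v R\<^sub>m = - (?L *s (?M *v ?P) + ?M *v ?Q + ?C *v ?P)"
      by (simp add: D_mat_mult matrix_vector_mult_sum vector_scalar_commute vec_eq_iff
          sum.distrib sum_distrib_left algebra_simps)
    show ?thesis
      unfolding D C_vec_def Y_vec_eq v_def
      by (simp add: matrix_vector_right_distrib matrix_vector_mult_add_rdistrib mat_scale_mult_vec
         vector_scalar_commute vec_eq_iff power2_eq_square algebra_simps)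
  qed
  finally show "(\<exists>wd\<^sub>m. invariance_at M C K f (w(m := w\<^sub>m)) (wd(m := wd\<^sub>m)) (R(m := R\<^sub>m)) m) \<longleftrightarrow>
      (cmat K + mat_scale ?L ?C + mat_scale (?L\<^sup>2) ?M) *v w\<^sub>m
      = D_mat M C lam \<phi> m *v R\<^sub>m + C_vec M C f lam w wd R m" .
qed

end
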